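(* Let $\mu$ be an Ahlfors-David probability measure on $\mathbb{R}^q$ with support $K_\mu$. There exist positive constants $d_1,d_2,d_3$ such that for each $n\geq 1$, every $\alpha_n\in C_n(\mu)$ and every Voronoi partition $\{P_a(\alpha_n)\}_{a\in\alpha_n}$ with respect to $\alpha_n$, we have \[ d_1n^{-1}\leq\min_{a\in\alpha_n}\mu(P_a(\alpha_n))\leq\max_{a\in\alpha_n}\mu(P_a(\alpha_n))\leq d_2n^{-1}. \] Moreover, for every $a\in\alpha_n$, the set $P_a(\alpha_n)$ contains a closed ball of radius $d_3|P_a(\alpha_n)\cap K_\mu|$ which is centered at $a$.
   Context: $d$ is the Euclidean metric on $\mathbb{R}^q$, $B(x,\epsilon)$ is the closed ball of radius $\epsilon$ centered at $x$, and $|B|$ is the diameter of a set $B\subset\mathbb{R}^q$. For $x\in\mathbb{R}^q$ and non-empty $\alpha\subset\mathbb{R}^q$, $d(x,\alpha):=\inf_{a\in\alpha}d(x,a)$. A Borel measure $\mu$ on $\mathbb{R}^q$ is called an Ahlfors-David measure (of dimension $s_0>0$) if there exist constants $C_1,C_2,\epsilon_0>0$ such that $C_1\epsilon^{s_0}\leq\mu(B(x,\epsilon))\leq C_2\epsilon^{s_0}$ for every $x\in\mathrm{supp}(\mu)$ and every $\epsilon\in(0,\epsilon_0)$. For $n\geq1$, $C_n(\mu)$ is the collection of all $n$-optimal sets for $\mu$ with respect to the geometric mean error (order zero), i.e. all sets $\alpha\subset\mathbb{R}^q$ with $1\leq\mathrm{card}(\alpha)\leq n$ at which the infimum $\inf\{\exp(\int\log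 d(x,\alpha)\,d\mu(x)):\alpha\subset\mathbb{R}^q,\,1\leq\mathrm{card}(\alpha)\leq n\}$ is attained. For a non-empty finite set $\alpha\subset\mathbb{R}^q$ and $a\in\alpha$, let $W(a|\alpha):=\{x\in\mathbb{R}^q:d(x,\alpha)=d(x,a)\}$. A Voronoi partition with respect to $\alpha$ is a Borel partition $\{P_a(\alpha)\}_{a\in\alpha}$ of $\mathbb{R}^q$ such that $P_a(\alpha)\subset W(a|\alpha)$ for every $a\in\alpha$. *)

theory Defs
  imports "HOL-Probability.Probability"
begin

definition msupport :: "'a::topological_space measure \<Rightarrow> 'a set" where
  "msupport \<mu> = {x. \<forall>U. open U \<and> x \<in> U \<longrightarrow> emeasure \<mu> U > 0}"

definition ahlfors_david :: "'a::metric_space measure \<Rightarrow> real \<Rightarrow> bool" where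
  "ahlfors_david \<mu> s \<longleftrightarrow>
     sets \<mu> = sets borel \<and> s > 0 \<and>
     (\<exists>C1 C2 \<epsilon>0. C1 > 0 \<and> C2 > 0 \<and> \<epsilon>0 > 0 \<and>
        (\<forall>x\<in>msupport \<mu>. \<forall>\<epsilon>. 0 < \<epsilon> \<and> \<epsilon> < \<epsilon>0 \<longrightarrow>
            ennreal (C1 * \<epsilon> powr s) \<le> emeasure \<mu> (cball x \<epsilon>) \<and>
            emeasure \<mu> (cball x \<epsilon>) \<le> ennreal (C2 * \<epsilon> powr s)))"

(* The integral of log d(x,alpha) as an extended real: positive part minus negative part,
   with log 0 = -infinity.  The Bochner integral would not do in general, since it is 0 for
   non-integrable functions and HOL sets ln 0 = 0.  Both parts rely on ennreal r = 0 for r < 0. *)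
definition log_dist_integral :: "'a::metric_space measure \<Rightarrow> 'a set \<Rightarrow> ereal" where
  "log_dist_integral \<mu> \<alpha> =
     enn2ereal (\<integral>\<^sup>+ x. ennreal (ln (infdist x \<alpha>)) \<partial>\<mu>)
     - enn2ereal (\<integral>\<^sup>+ x. (if infdist x \<alpha> = 0 then \<infinity> else ennreal (- ln (infdist x \<alpha>))) \<partial>\<mu>)"

fun exp_ereal :: "ereal \<Rightarrow> ereal" where
  "exp_ereal (ereal r) = ereal (exp r)"
| "exp_ereal PInfty = \<infinity>"
| "exp_ereal MInfty = 0"

definition geom_mean_error :: "'a::metric_space measure \<Rightarrow> 'a set \<Rightarrow> ereal" where
  "geom_mean_error \<mu> \<alpha> = exp_ereal (log_dist_integral \<mu> \<alpha>)"

(* The condition 1 <= card alpha forces alpha to be finite, as card is 0 on infinite sets. *)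
definition optimal_sets :: "nat \<Rightarrow> 'a::metric_space measure \<Rightarrow> 'a set set" where
  "optimal_sets n \<mu> =
     {\<alpha>. 1 \<le> card \<alpha> \<and> card \<alpha> \<le> n \<and>
         geom_mean_error \<mu> \<alpha> = (INF \<beta>\<in>{\<beta>. 1 \<le> card \<beta> \<and> card \<beta> \<le> n}. geom_mean_error \<mu> \<beta>)}"

definition voronoi_region :: "'a::metric_space \<Rightarrow> 'a set \<Rightarrow> 'a set" where
  "voronoi_region a \<alpha> = {x. infdist x \<alpha> = dist x a}"

definition voronoi_partition :: "'a::metric_space set \<Rightarrow> ('a \<Rightarrow> 'a set) \<Rightarrow> bool" where
  "voronoi_partition \<alpha> P \<longleftrightarrow>
     (\<forall>a\<in>\<alpha>. P a \<in> sets borel \<and> P a \<subseteq> voronoi_region a \<alpha>) \<and>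
     disjoint_family_on P \<alpha> \<and> (\<Union>a\<in>\<alpha>. P a) = UNIV"

end

theory Submission
  imports Defs
begin

text \<open>Everything follows from comparing the logarithmic error of a set with that of the set with one
  point added or removed. Adding a point of the support at distance \<open>R\<close> gains at least a multiple
  of \<open>R powr s\<close>; since \<open>n\<close> small balls cannot cover the support, some point always gains at least a
  multiple of \<open>1/n\<close>. Removing a point costs at most a multiple of the mass of its cell. Hence for
  an optimal set every cell has mass at least of order \<open>1/n\<close>, and exchanging the point with the
  lightest cell for a remote point of the support shows that no point of the support is farther
  than order \<open>n powr (-1/s)\<close>, which bounds the mass and the diameter of the cells from above.
  If two points were much closer than \<open>n powr (-1/s)\<close>, then removing one of them would be too cheap,
  so each point is the centre of a ball of that order inside its cell.\<close>

text \<open>The form of the Ahlfors-David condition that the argument uses. The upper bound is asked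
  for all centres and all radii because the points of an optimal set may lie off \<open>K\<close>.
  The lower bound is limited to centres in \<open>K\<close> and radii up to \<open>D\<close>, as the
  total mass is 1.\<close>

locale regular_measure = prob_space M
  for M :: "'a::{metric_space, second_countable_topology} measure" +
  fixes K :: "'a set" and s C c D :: real
  assumes sets_M: "sets M = sets borel"
    and s_pos: "s > 0" and C_pos: "C > 0" and c_pos: "c > 0" and D_pos: "D > 0"
    and AE_K: "AE x in M. x \<in> K"
    and dist_K: "\<And>x y. x \<in> K \<Longrightarrow> y \<in> K \<Longrightarrow> dist x y \<le> D"
    and upper: "\<And>x r. r > 0 \<Longrightarrow> measure M (cball x r) \<le> C * r powr s"
    and lower: "\<And>x r. x \<in> K \<Longrightarrow> 0 < r \<Longrightarrow> r \<le> D \<Longrightarrow> c * r powr s \<le> measure M (cball x r)"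
begin

section \<open>Measurability of the basic functions\<close>

lemma space_M [simp]: "space M = UNIV"
  using sets_eq_imp_space_eq[OF sets_M] by simp

lemma borel_sets_M: "A \<in> sets borel \<Longrightarrow> A \<in> sets M"
  by (simp add: sets_M)

lemma borel_measurable_M: "f \<in> borel_measurable borel \<Longrightarrow> f \<in> borel_measurable M"
  by (simp add: measurable_cong_sets[OF sets_M refl])

lemma infdist_measurable [measurable]: "(\<lambda>x. infdist x \<beta>) \<in> borel_measurable M"
  by (intro borel_measurable_M borel_measurable_continuous_onI continuous_intros)

lemma dist_measurable [measurable]: "(\<lambda>x. dist x b) \<in> borel_measurable M"
  by (intro borel_measurable_M borel_measurable_continuous_onI continuous_intros)

lemma cball_sets [measurable]: "cball b r \<in> sets M"
  by (simp add: sets_M)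

lemma integrable_indicator_M: "A \<in> sets M \<Longrightarrow> integrable M (indicat_real A)"
  by (simp add: integrable_indicator_iff emeasure_eq_measure)

section \<open>The logarithmic singularity at a point\<close>

definition log_ball_const :: real where
  "log_ball_const = C / (1 - exp (-s))"

lemma log_ball_const_pos: "log_ball_const > 0"
  using C_pos s_pos by (simp add: log_ball_const_def)

text \<open>The positive part of \<open>ln (r / dist x b)\<close>. At \<open>x = b\<close> the
  conventions for division by zero and \<open>ln 0\<close> make it 0, which is harmless because
  single points turn out to be null.\<close>

definition log_ball :: "'a \<Rightarrow> real \<Rightarrow> 'a \<Rightarrow> real" where
  "log_ball b r x = indicator (cball b r) x * ln (r / dist x b)"

lemma log_ball_measurable [measurable]: "log_ball b r \<in> borel_measurable M"
  unfolding log_ball_def[abs_def] by measurable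

lemma log_ball_nonneg: "r > 0 \<Longrightarrow> 0 \<le> log_ball b r x"
  by (cases "x = b") (auto simp: log_ball_def indicator_def dist_commute)

text \<open>Counting the radii \<open>r * exp (-j)\<close> that exceed \<open>dist x b\<close> replaces the layer-cake formula.\<close>

lemma log_ball_le_suminf:
  assumes "r > 0"
  shows "ennreal (log_ball b r x) \<le> (\<Sum>j. indicator (cball b (r * exp (- real j))) x)"
proof (cases "x \<in> cball b r \<and> x \<noteq> b")
  case False
  then have "log_ball b r x = 0"
    by (auto simp: log_ball_def)
  then show ?thesis by simp
next
  case True
  define d where "d = dist x b"
  have d: "0 < d" "d \<le> r" using True by (auto simp: d_def dist_commute)
  \<comment> \<open>The radii \<open>r * exp (-j)\<close> with \<open>j \<le> N\<close> all reach
    \<open>x\<close>. As \<open>j = 0\<close> is included, there are \<open>N + 1\<close> of them,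
    hence at least \<open>ln (r / d)\<close>.\<close>
  define N where "N = nat \<lfloor>ln (r / d)\<rfloor>"
  have ln0: "ln (r / d) \<ge> 0" using d by simp
  have N: "real N \<le> ln (r / d)" "ln (r / d) \<le> real (Suc N)"
    unfolding N_def using ln0 by linarith+
  have in_ball: "x \<in> cball b (r * exp (- real j))" if "j < Suc N" for j
  proof -
    have "real j \<le> ln (r / d)" using that N(1) by linarith
    then have "exp (real j) \<le> r / d" using d assms by (simp add: ln_ge_iff)
    then have "d \<le> r * exp (- real j)"
      using d by (simp add: exp_minus field_simps)
    then show ?thesis by (simp add: d_def dist_commute)
  qed
  have "ennreal (log_ball b r x) = ennreal (ln (r / d))"
    using True by (simp add: log_ball_def d_def)
  also have "\<dots> \<le> ennreal (real (Suc N))" using N(2) by (rule ennreal_leI)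
  also have "\<dots> = (\<Sum>j<Suc N. 1)" by (simp add: ennreal_of_nat_eq_real_of_nat)
  also have "\<dots> = (\<Sum>j<Suc N. indicator (cball b (r * exp (- real j))) x)"
    using in_ball by (intro sum.cong refl) (auto simp: indicator_def)
  also have "\<dots> \<le> (\<Sum>j. indicator (cball b (r * exp (- real j))) x)"
    by (rule sum_le_suminf) auto
  finally show ?thesis .
qed

text \<open>Integrating the count of radii term by term and applying \<open>upper\<close> to each
  ball leaves a geometric series of ratio \<open>exp (-s)\<close>, whose sum explains
  \<open>log_ball_const\<close>.\<close>

lemma nn_integral_log_ball:
  assumes "r > 0"
  shows "(\<integral>\<^sup>+ x. ennreal (log_ball b r x) \<partial>M) \<le> ennreal (log_ball_const * r powr s)"
proof -
  have sum: "summable (\<lambda>j. C * r powr s * exp (-s) ^ j)"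
    using s_pos by (intro summable_mult summable_geometric) simp
  have "(\<integral>\<^sup>+ x. ennreal (log_ball b r x) \<partial>M)
      \<le> (\<integral>\<^sup>+ x. (\<Sum>j. indicator (cball b (r * exp (- real j))) x) \<partial>M)"
    using log_ball_le_suminf[OF assms] by (intro nn_integral_mono) auto
  also have "\<dots> = (\<Sum>j. emeasure M (cball b (r * exp (- real j))))"
    by (subst nn_integral_suminf) (auto simp: cball_sets)
  also have "\<dots> \<le> (\<Sum>j. ennreal (C * r powr s * exp (-s) ^ j))"
  proof (intro suminf_le allI)
    fix j
    have "(r * exp (- real j)) powr s = r powr s * exp (-s) ^ j"
      using assms by (simp add: powr_mult powr_def[of "exp _"] exp_of_nat_mult[symmetric] mult.commute)
    then show "emeasure M (cball b (r * exp (- real j))) \<le> ennreal (C * r powr s * exp (-s) ^ j)"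
      using upper[of "r * exp (- real j)" b] assms
      by (simp only: emeasure_eq_measure mult.assoc, intro ennreal_leI) auto
  qed auto
  also have "\<dots> = ennreal (\<Sum>j. C * r powr s * exp (-s) ^ j)"
    using C_pos sum by (intro suminf_ennreal2) auto
  also have "(\<Sum>j. C * r powr s * exp (-s) ^ j) = log_ball_const * r powr s"
    using s_pos by (subst suminf_mult) (auto simp: suminf_geometric log_ball_const_def summable_geometric)
  finally show ?thesis .
qed

lemma integrable_log_ball: "r > 0 \<Longrightarrow> integrable M (log_ball b r)"
  using nn_integral_log_ball[of r b] log_ball_nonneg[of r b]
  by (intro integrableI_nonneg) (auto intro: le_less_trans)

lemma integral_log_ball:
  assumes "r > 0"
  shows "(\<integral>x. log_ball b r x \<partial>M) \<le> log_ball_const * r powr s"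
proof -
  have "ennreal (\<integral>x. log_ball b r x \<partial>M) \<le> ennreal (log_ball_const * r powr s)"
    using nn_integral_log_ball[OF assms, of b] integrable_log_ball[OF assms, of b] log_ball_nonneg[OF assms]
    by (subst nn_integral_eq_integral[symmetric]) auto
  then show ?thesis using log_ball_const_pos by (subst (asm) ennreal_le_iff) auto
qed

section \<open>Null sets and distances to finite sets\<close>

lemma measure_singleton: "measure M {b} = 0"
proof -
  have "measure M {b} \<le> e" if "e > 0" for e
  proof -
    define r where "r = (e / C) powr (1 / s)"
    have r: "r > 0" "r powr s = e / C" using that C_pos s_pos by (auto simp: r_def powr_powr)
    have "measure M {b} \<le> measure M (cball b r)"
      using r by (intro finite_measure_mono) (auto simp: cball_sets)
    then show ?thesis using upper[OF r(1), of b] r C_pos by auto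
  qed
  then show ?thesis by (meson field_le_epsilon measure_nonneg order_antisym add_0 le_add_same_cancel1 dense_ge)
qed

text \<open>Lets the pointwise estimates assume a positive distance to \<beta>, so that the
  convention \<open>ln 0 = 0\<close> has no influence on the integrals.\<close>

lemma AE_not_in_finite:
  assumes "finite \<beta>"
  shows "AE x in M. x \<notin> \<beta>"
proof -
  have "AE x in M. x \<noteq> b" for b
    using measure_singleton[of b]
    by (intro AE_I[of _ _ "{b}"]) (auto simp: emeasure_eq_measure sets_M)
  then have "AE x in M. \<forall>b\<in>\<beta>. x \<noteq> b"
    using assms by (subst AE_finite_all) auto
  then show ?thesis by (rule AE_mp) auto
qed

lemma K_nonempty: "K \<noteq> {}"
  using AE_K AE_False by auto

lemma infdist_attained:
  assumes "finite \<beta>" "\<beta> \<noteq> {}"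
  obtains b where "b \<in> \<beta>" "infdist x \<beta> = dist x b"
proof -
  have "Min (dist x ` \<beta>) \<in> dist x ` \<beta>" using assms by (intro Min_in) auto
  then show thesis
    using assms that by (force simp: infdist_notempty cInf_eq_Min)
qed

lemma infdist_pos_finite:
  assumes "finite \<beta>" "\<beta> \<noteq> {}" "x \<notin> \<beta>"
  shows "infdist x \<beta> > 0"
  using assms infdist_pos_not_in_closed finite_imp_closed by blast

lemma infdist_insert:
  assumes "\<gamma> \<noteq> {}"
  shows "infdist x (insert b \<gamma>) = min (dist x b) (infdist x \<gamma>)"
  using infdist_Un_min[of "{b}" \<gamma> x] assms by simp

section \<open>Logarithmic error and optimal sets\<close>

definition log_error :: "'a set \<Rightarrow> real" where
  "log_error \<beta> = (\<integral>x. ln (infdist x \<beta>) \<partial>M)"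

text \<open>The logarithm is bounded above on \<open>K\<close> because \<open>K\<close> is bounded,
  and its negative part is at most \<open>log_ball a 1\<close> for a nearest point \<open>a\<close>.
  Summing over all of \<beta> avoids a measurable selection of \<open>a\<close>.\<close>

lemma integrable_ln_infdist:
  assumes "finite \<beta>" "\<beta> \<noteq> {}"
  shows "integrable M (\<lambda>x. ln (infdist x \<beta>))"
proof -
  obtain k where k: "k \<in> K" using K_nonempty by auto
  obtain b where b: "b \<in> \<beta>" using assms by auto
  define R where "R = dist k b + D + 1"
  have R: "R \<ge> 1" using D_pos by (simp add: R_def add_nonneg_nonneg)
  have int: "integrable M (\<lambda>x. ln R + (\<Sum>b\<in>\<beta>. log_ball b 1 x))"
    by (intro Bochner_Integration.integrable_add Bochner_Integration.integrable_sum integrable_log_ball) auto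
  show ?thesis
  proof (rule Bochner_Integration.integrable_bound[OF int])
    show "AE x in M. norm (ln (infdist x \<beta>)) \<le> norm (ln R + (\<Sum>b\<in>\<beta>. log_ball b 1 x))"
      using AE_K AE_not_in_finite[OF assms(1)]
    proof eventually_elim
      fix x assume x: "x \<in> K" "x \<notin> \<beta>"
      have pos: "infdist x \<beta> > 0" using infdist_pos_finite assms x by blast
      have "infdist x \<beta> \<le> dist x b" using b by (rule infdist_le)
      also have "\<dots> \<le> R" using dist_K[OF x(1) k] dist_triangle[of x b k] by (simp add: R_def)
      finally have up: "ln (infdist x \<beta>) \<le> ln R" using pos by simp
      obtain a where a: "a \<in> \<beta>" "infdist x \<beta> = dist x a"
        using infdist_attained assms by blast
      have "- ln (infdist x \<beta>) \<le> log_ball a 1 x"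
        using a pos by (auto simp: log_ball_def ln_div dist_commute indicator_def)
      also have "\<dots> \<le> (\<Sum>b\<in>\<beta>. log_ball b 1 x)"
        using a assms by (intro member_le_sum log_ball_nonneg) auto
      finally have lo: "- ln (infdist x \<beta>) \<le> (\<Sum>b\<in>\<beta>. log_ball b 1 x)" .
      have "0 \<le> (\<Sum>b\<in>\<beta>. log_ball b 1 x)" "0 \<le> ln R"
        using R by (auto intro!: sum_nonneg log_ball_nonneg)
      then show "norm (ln (infdist x \<beta>)) \<le> norm (ln R + (\<Sum>b\<in>\<beta>. log_ball b 1 x))"
        using up lo by auto
    qed
  qed measurable
qed

text \<open>The special value at distance 0 concerns only the null set \<beta>, and the positive and
  negative parts are both finite, so their extended-real difference is the Bochner integral.\<close>

lemma log_dist_integral_eq: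
  assumes "finite \<beta>" "\<beta> \<noteq> {}"
  shows "log_dist_integral M \<beta> = ereal (log_error \<beta>)"
proof -
  note int = integrable_ln_infdist[OF assms]
  have fin: "(\<integral>\<^sup>+ x. ennreal (ln (infdist x \<beta>)) \<partial>M) < \<infinity>"
      "(\<integral>\<^sup>+ x. ennreal (- ln (infdist x \<beta>)) \<partial>M) < \<infinity>"
    using int unfolding real_integrable_def by (auto simp: less_top)
  have "(\<integral>\<^sup>+ x. (if infdist x \<beta> = 0 then \<infinity> else ennreal (- ln (infdist x \<beta>))) \<partial>M)
      = (\<integral>\<^sup>+ x. ennreal (- ln (infdist x \<beta>)) \<partial>M)"
  proof (rule nn_integral_cong_AE)
    show "AE x in M. (if infdist x \<beta> = 0 then \<infinity> else ennreal (- ln (infdist x \<beta>)))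
        = ennreal (- ln (infdist x \<beta>))"
      using AE_not_in_finite[OF assms(1)]
    proof eventually_elim
      case (elim x)
      then show ?case using infdist_pos_finite[OF assms, of x] by auto
    qed
  qed
  moreover have "enn2ereal t = ereal (enn2real t)" if "t < \<infinity>" for t :: ennreal
    using that by (cases t) auto
  ultimately show ?thesis
    using fin by (simp add: log_dist_integral_def log_error_def real_lebesgue_integral_def[OF int])
qed

text \<open>The last fact is how optimality enters the argument. Both logarithmic errors are real,
  so the exponential can be removed from the comparison.\<close>

lemma optimal_setsD:
  assumes "\<alpha> \<in> optimal_sets n M"
  shows "finite \<alpha>" "\<alpha> \<noteq> {}" "card \<alpha> \<le> n"
    and "\<And>\<beta>. finite \<beta> \<Longrightarrow> \<beta> \<noteq> {} \<Longrightarrow> card \<beta> \<le> n \<Longrightarrow> log_error \<alpha> \<le> log_error \<beta>"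
proof -
  have card: "1 \<le> card \<alpha>" "card \<alpha> \<le> n" using assms by (auto simp: optimal_sets_def)
  then have "card \<alpha> \<noteq> 0" by simp
  then show \<alpha>: "finite \<alpha>" "\<alpha> \<noteq> {}" "card \<alpha> \<le> n" using card by (auto simp: card_eq_0_iff)
  fix \<beta> :: "'a set" assume \<beta>: "finite \<beta>" "\<beta> \<noteq> {}" "card \<beta> \<le> n"
  then have "1 \<le> card \<beta>" by (simp add: card_gt_0_iff Suc_le_eq)
  then have "geom_mean_error M \<alpha> \<le> geom_mean_error M \<beta>"
    using assms \<beta> by (auto simp: optimal_sets_def intro: INF_lower)
  then show "log_error \<alpha> \<le> log_error \<beta>"
    using \<alpha>(1-3) \<beta> by (simp add: geom_mean_error_def log_dist_integral_eq)
qed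

lemma optimal_sets_pos: "\<alpha> \<in> optimal_sets n M \<Longrightarrow> n > 0"
  by (auto simp: optimal_sets_def)

section \<open>Strict Voronoi cells and the cost of removing a point\<close>

definition strict_cell :: "'a \<Rightarrow> 'a set \<Rightarrow> 'a set" where
  "strict_cell b \<beta> = {x. dist x b < infdist x (\<beta> - {b})}"

lemma strict_cell_sets [measurable]: "strict_cell b \<beta> \<in> sets M"
  unfolding strict_cell_def
  by (intro borel_sets_M borel_open open_Collect_less continuous_intros)

lemma ball_subset_strict_cell:
  assumes "2 * r \<le> infdist b (\<beta> - {b})"
  shows "ball b r \<subseteq> strict_cell b \<beta>"
proof
  fix y assume "y \<in> ball b r"
  then show "y \<in> strict_cell b \<beta>"
    using assms infdist_triangle[of b "\<beta> - {b}" y]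
    by (auto simp: strict_cell_def dist_commute)
qed

text \<open>Strictness rules out ties, so disjointness holds without any choice on the
  boundaries.\<close>

lemma strict_cell_disjoint:
  "disjoint_family_on (\<lambda>b. strict_cell b \<beta>) \<beta>"
proof -
  have False if "a \<in> \<beta>" "b \<in> \<beta>" "a \<noteq> b" "x \<in> strict_cell a \<beta>" "x \<in> strict_cell b \<beta>" for a b x
    using that infdist_le[of b "\<beta> - {a}" x] infdist_le[of a "\<beta> - {b}" x]
    by (auto simp: strict_cell_def)
  then show ?thesis unfolding disjoint_family_on_def by blast
qed

text \<open>Pigeonhole for disjoint sets of total mass at most 1. Passing to a subset \<gamma> makes
  it possible to exempt a newly added point of \<beta> from removal.\<close>

lemma exists_light_strict_cell:
  assumes "finite \<gamma>" "\<gamma> \<noteq> {}" "\<gamma> \<subseteq> \<beta>"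
  shows "\<exists>b\<in>\<gamma>. measure M (strict_cell b \<beta>) \<le> 1 / card \<gamma>"
proof (rule ccontr)
  assume "\<not> ?thesis"
  then have "(\<Sum>b\<in>\<gamma>. 1 / card \<gamma>) < (\<Sum>b\<in>\<gamma>. measure M (strict_cell b \<beta>))"
    using assms by (intro sum_strict_mono) auto
  also have "\<dots> = measure M (\<Union>b\<in>\<gamma>. strict_cell b \<beta>)"
    using assms disjoint_family_on_mono[OF assms(3) strict_cell_disjoint]
    by (intro finite_measure_finite_Union[symmetric]) (auto simp: strict_cell_sets)
  also have "\<dots> \<le> 1" by simp
  finally show False using assms by simp
qed

text \<open>Only points in the strict cell of \<open>b\<close> are affected, and their new distance
  is at most \<open>dist x b\<close> plus the distance \<delta> from \<open>b\<close> to the other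
  points. The radius \<open>r\<close> stays free: it is a fraction of \<delta> when the cost is
  compared with the mass of the cell, and of order \<open>n powr (-1/s)\<close> when points are
  shown to be separated.\<close>

lemma log_error_remove_le:
  assumes "finite \<beta>" "b \<in> \<beta>" "\<beta> - {b} \<noteq> {}" "r > 0"
  shows "log_error (\<beta> - {b}) \<le> log_error \<beta> + (\<integral>x. log_ball b r x \<partial>M)
      + measure M (strict_cell b \<beta>) * ln (1 + infdist b (\<beta> - {b}) / r)"
proof -
  define \<gamma> where "\<gamma> = \<beta> - {b}"
  define \<delta> where "\<delta> = infdist b \<gamma>"
  define V where "V = strict_cell b \<beta>"
  have \<gamma>: "finite \<gamma>" "\<gamma> \<noteq> {}" "\<beta> = insert b \<gamma>" using assms by (auto simp: \<gamma>_def)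
  have V [measurable]: "V \<in> sets M" by (simp add: V_def strict_cell_sets)
  have \<delta>: "\<delta> \<ge> 0" by (simp add: \<delta>_def infdist_nonneg)
  have int: "integrable M (\<lambda>x. ln (infdist x \<beta>) + log_ball b r x + indicator V x * ln (1 + \<delta> / r))"
    using assms
    by (intro Bochner_Integration.integrable_add integrable_ln_infdist integrable_log_ball
        integrable_mult_left integrable_indicator_M V) auto
  have "log_error \<gamma> \<le> (\<integral>x. ln (infdist x \<beta>) + log_ball b r x + indicator V x * ln (1 + \<delta> / r) \<partial>M)"
    unfolding log_error_def
  proof (rule integral_mono_AE[OF integrable_ln_infdist[OF \<gamma>(1,2)] int])
    show "AE x in M. ln (infdist x \<gamma>)
        \<le> ln (infdist x \<beta>) + log_ball b r x + indicator V x * ln (1 + \<delta> / r)"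
      using AE_not_in_finite[OF assms(1)]
    proof eventually_elim
      fix x assume x: "x \<notin> \<beta>"
      have log0: "log_ball b r x \<ge> 0" using assms by (intro log_ball_nonneg)
      have min: "infdist x \<beta> = min (dist x b) (infdist x \<gamma>)"
        unfolding \<gamma>(3) by (rule infdist_insert[OF \<gamma>(2)])
      show "ln (infdist x \<gamma>) \<le> ln (infdist x \<beta>) + log_ball b r x + indicator V x * ln (1 + \<delta> / r)"
      proof (cases "x \<in> V")
        case False
        then have "infdist x \<beta> = infdist x \<gamma>"
          using min by (auto simp: V_def strict_cell_def \<gamma>_def)
        then show ?thesis using False log0 by simp
      next
        case True
        define d where "d = dist x b"
        have d: "d > 0" using x \<gamma>(3) by (auto simp: d_def)
        have i\<beta>: "infdist x \<beta> = d" "d < infdist x \<gamma>"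
          using True min by (auto simp: V_def strict_cell_def \<gamma>_def d_def)
        have "infdist x \<gamma> \<le> d + \<delta>"
          using infdist_triangle[of x \<gamma> b] by (simp add: d_def \<delta>_def)
        then have le: "ln (infdist x \<gamma>) \<le> ln (d + \<delta>)" using i\<beta> d by simp
        \<comment> \<open>Within distance \<open>r\<close> of \<open>b\<close>,
          \<open>log_ball\<close> lifts \<open>ln d\<close> to \<open>ln r\<close>. Beyond it,
          \<delta> is at most \<open>d * \<delta> / r\<close>.\<close>
        have "ln (d + \<delta>) \<le> ln d + log_ball b r x + ln (1 + \<delta> / r)"
        proof (cases "d \<le> r")
          case True
          then have "log_ball b r x = ln r - ln d"
            using d assms by (simp add: log_ball_def d_def dist_commute ln_div)
          moreover have "ln r + ln (1 + \<delta> / r) = ln (r + \<delta>)"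
            using assms(4) \<delta> ln_mult_pos[of r "1 + \<delta> / r"] by (simp add: distrib_left add_pos_nonneg)
          moreover have "ln (d + \<delta>) \<le> ln (r + \<delta>)" using True d \<delta> by simp
          ultimately show ?thesis by simp
        next
          case False
          have "d + \<delta> \<le> d * (1 + \<delta> / r)"
            using False assms(4) \<delta> mult_right_mono[of r d \<delta>] by (simp add: field_simps)
          then have "ln (d + \<delta>) \<le> ln (d * (1 + \<delta> / r))"
            using d \<delta> by (intro ln_mono) auto
          also have "\<dots> = ln d + ln (1 + \<delta> / r)"
            using d assms(4) \<delta> by (intro ln_mult_pos) (auto simp: add_pos_nonneg)
          finally show ?thesis using log0 by simp
        qed
        then show ?thesis using le i\<beta> True by simp
      qed
    qed
  qed
  also have "\<dots> = log_error \<beta> + (\<integral>x. log_ball b r x \<partial>M) + measure M V * ln (1 + \<delta> / r)"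
  proof -
    have "\<beta> \<noteq> {}" using assms(2) by auto
    note integrable_ln_infdist[OF assms(1) this] integrable_log_ball[OF assms(4), of b]
      integrable_mult_left[OF integrable_indicator_M[OF V], of "ln (1 + \<delta> / r)"]
    then show ?thesis by (simp add: log_error_def)
  qed
  finally show ?thesis by (simp add: \<gamma>_def \<delta>_def V_def)
qed

text \<open>The term \<open>ln 9\<close> is \<open>ln (1 + \<delta> / r)\<close> at
  \<open>r = \<delta> / 8\<close>. The other term pays for the singular integral, of order
  \<open>r powr s\<close>, with the mass of a ball of radius \<open>r\<close> in the cell.\<close>

definition removal_const :: real where
  "removal_const = log_ball_const / c + ln 9"

lemma removal_const_pos: "removal_const > 0"
  using log_ball_const_pos c_pos by (simp add: removal_const_def add_pos_pos)

text \<open>If \<open>b\<close> is near \<open>K\<close>, then its strict cell contains a ball of radius comparable to the distance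
  from \<open>b\<close> to the other points; otherwise the logarithmic singularity at \<open>b\<close> is not seen by \<open>M\<close>.\<close>

lemma log_error_remove_le_measure:
  assumes "finite \<beta>" "b \<in> \<beta>" "\<beta> - {b} \<noteq> {}"
    and near: "\<And>k. k \<in> K \<Longrightarrow> dist b k \<le> infdist b (\<beta> - {b}) / 8 \<Longrightarrow> infdist b (\<beta> - {b}) \<le> 8 * D"
  shows "log_error (\<beta> - {b}) \<le> log_error \<beta> + removal_const * measure M (strict_cell b \<beta>)"
proof -
  define \<delta> where "\<delta> = infdist b (\<beta> - {b})"
  have \<delta>: "\<delta> > 0" unfolding \<delta>_def using assms by (intro infdist_pos_finite) auto
  have "(\<integral>x. log_ball b (\<delta> / 8) x \<partial>M) \<le> log_ball_const / c * measure M (strict_cell b \<beta>)"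
  proof (cases "\<exists>k\<in>K. dist b k \<le> \<delta> / 8")
    case True
    then obtain k where k: "k \<in> K" "dist b k \<le> \<delta> / 8" by auto
    have "cball k (\<delta> / 8) \<subseteq> ball b (\<delta> / 2)"
    proof
      fix y assume "y \<in> cball k (\<delta> / 8)"
      then show "y \<in> ball b (\<delta> / 2)"
        using k(2) \<delta> dist_triangle[of b y k] unfolding mem_cball mem_ball by linarith
    qed
    also have "\<dots> \<subseteq> strict_cell b \<beta>"
      by (intro ball_subset_strict_cell) (simp add: \<delta>_def)
    finally have "measure M (cball k (\<delta> / 8)) \<le> measure M (strict_cell b \<beta>)"
      by (intro finite_measure_mono) (auto simp: strict_cell_sets)
    \<comment> \<open>By \<open>near\<close>, the radius \<open>\<delta> / 8\<close> is at most
      \<open>D\<close>, the range in which \<open>lower\<close> applies.\<close>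
    then have le: "c * (\<delta> / 8) powr s \<le> measure M (strict_cell b \<beta>)"
      using lower[of k "\<delta> / 8"] near[of k] k \<delta> by (auto simp: \<delta>_def)
    have "(\<integral>x. log_ball b (\<delta> / 8) x \<partial>M) \<le> log_ball_const * (\<delta> / 8) powr s"
      using \<delta> by (intro integral_log_ball) auto
    also have "\<dots> = log_ball_const / c * (c * (\<delta> / 8) powr s)"
      using c_pos by simp
    also have "\<dots> \<le> log_ball_const / c * measure M (strict_cell b \<beta>)"
      using le log_ball_const_pos c_pos by (intro mult_left_mono) auto
    finally show ?thesis .
  next
    case False
    have "(\<integral>x. log_ball b (\<delta> / 8) x \<partial>M) = (\<integral>x. 0 \<partial>M)"
    proof (rule integral_cong_AE)
      show "AE x in M. log_ball b (\<delta> / 8) x = 0"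
        using AE_K
      proof eventually_elim
        case (elim x)
        then show ?case using False by (auto simp: log_ball_def indicator_def)
      qed
    qed measurable
    then show ?thesis using log_ball_const_pos c_pos by simp
  qed
  then show ?thesis
    using log_error_remove_le[OF assms(1-3), of "\<delta> / 8"] \<delta>
    by (simp add: \<delta>_def[symmetric] removal_const_def algebra_simps)
qed

section \<open>The gain from adding a point\<close>

lemma log_error_insert_le:
  assumes "finite \<beta>" "\<beta> \<noteq> {}" "x \<in> K" "0 < r" "r \<le> D" "4 * r \<le> infdist x \<beta>"
  shows "log_error (insert x \<beta>) \<le> log_error \<beta> - c * r powr s * ln 3"
proof -
  have int: "integrable M (\<lambda>y. ln (infdist y \<beta>) - indicator (cball x r) y * ln 3)"
    using assms
    by (intro Bochner_Integration.integrable_diff integrable_ln_infdist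
        integrable_mult_left integrable_indicator_M cball_sets) auto
  have "log_error (insert x \<beta>) \<le> (\<integral>y. ln (infdist y \<beta>) - indicator (cball x r) y * ln 3 \<partial>M)"
    unfolding log_error_def
  proof (rule integral_mono_AE[OF integrable_ln_infdist int])
    have "finite (insert x \<beta>)" using assms by simp
    from AE_not_in_finite[OF this]
    show "AE y in M. ln (infdist y (insert x \<beta>)) \<le> ln (infdist y \<beta>) - indicator (cball x r) y * ln 3"
    proof eventually_elim
      fix y assume y: "y \<notin> insert x \<beta>"
      have min: "infdist y (insert x \<beta>) = min (dist y x) (infdist y \<beta>)"
        using assms by (intro infdist_insert)
      have pos: "infdist y (insert x \<beta>) > 0" using assms y by (intro infdist_pos_finite) auto
      show "ln (infdist y (insert x \<beta>)) \<le> ln (infdist y \<beta>) - indicator (cball x r) y * ln 3"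
      proof (cases "y \<in> cball x r")
        case False
        then show ?thesis using pos min by simp
      next
        case True
        \<comment> \<open>On the ball the old distance is at least \<open>3 * r\<close> and the new
          one at most \<open>r\<close>, so the logarithm drops by at least
          \<open>ln 3\<close>.\<close>
        have "4 * r \<le> infdist y \<beta> + dist x y"
          using assms infdist_triangle[of x \<beta> y] by linarith
        then have "3 * infdist y (insert x \<beta>) \<le> infdist y \<beta>"
          using True min by (auto simp: dist_commute)
        then have "ln (3 * infdist y (insert x \<beta>)) \<le> ln (infdist y \<beta>)"
          using pos by (intro ln_mono) auto
        then show ?thesis using True pos by (simp add: ln_mult)
      qed
    qed
  qed (use assms in auto)
  also have "\<dots> = log_error \<beta> - measure M (cball x r) * ln 3"
    using integrable_ln_infdist[of \<beta>] assms
    by (subst Bochner_Integration.integral_diff)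
      (auto simp: log_error_def cball_sets intro: integrable_indicator_M)
  also have "\<dots> \<le> log_error \<beta> - c * r powr s * ln 3"
    using lower[of x r] assms by simp
  finally show ?thesis .
qed

text \<open>The first entry of the minimum makes \<open>n\<close> balls of radius
  \<open>4 * far_const * n powr (-1/s)\<close> carry at most half of the mass. The cap
  \<open>D\<close> keeps the radius within the range of \<open>log_error_insert_le\<close>.\<close>

definition far_const :: real where
  "far_const = min ((1 / (2 * C)) powr (1 / s) / 4) D"

lemma far_const_pos: "far_const > 0"
  using C_pos D_pos by (simp add: far_const_def)

text \<open>Otherwise the balls of radius \<open>r\<close> about \<beta>, each of mass at most
  \<open>1 / (2 * n)\<close>, would cover \<open>K\<close> and hence carry the full mass 1.\<close>

lemma exists_far_point:
  assumes "finite \<beta>" "\<beta> \<noteq> {}" "card \<beta> \<le> n"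
  shows "\<exists>x\<in>K. 4 * (far_const * (1 / real n) powr (1 / s)) \<le> infdist x \<beta>"
proof (rule ccontr)
  assume "\<not> ?thesis"
  then have near: "infdist x \<beta> < 4 * (far_const * (1 / real n) powr (1 / s))" if "x \<in> K" for x
    using that by force
  have n: "n > 0" using assms by (metis card_gt_0_iff le_0_eq not_gr0)
  define r where "r = (1 / (2 * C)) powr (1 / s) * (1 / real n) powr (1 / s)"
  have r: "r > 0" using C_pos n by (simp add: r_def)
  have r_powr: "r powr s = 1 / (2 * C * real n)"
    using C_pos s_pos n by (simp add: r_def powr_mult powr_powr)
  have le_r: "4 * (far_const * (1 / real n) powr (1 / s)) \<le> r"
    using mult_right_mono[of "4 * far_const" "(1 / (2 * C)) powr (1 / s)" "(1 / real n) powr (1 / s)"]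
    by (simp add: far_const_def r_def mult.assoc min_def)
  have "AE x in M. x \<in> (\<Union>b\<in>\<beta>. cball b r)"
    using AE_K
  proof eventually_elim
    case (elim x)
    obtain b where "b \<in> \<beta>" "infdist x \<beta> = dist x b"
      using infdist_attained assms by blast
    then show ?case using near[OF elim] le_r by (auto simp: dist_commute intro!: bexI[of _ b])
  qed
  moreover have "(\<Union>b\<in>\<beta>. cball b r) \<in> sets M"
    using assms(1) by (intro sets.finite_UN cball_sets)
  ultimately have "1 = measure M (\<Union>b\<in>\<beta>. cball b r)"
    using prob_eq_1 by simp
  also have "\<dots> \<le> (\<Sum>b\<in>\<beta>. measure M (cball b r))"
    using assms by (intro finite_measure_subadditive_finite) (auto simp: cball_sets)
  also have "\<dots> \<le> (\<Sum>b\<in>\<beta>. C * r powr s)"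
    using r by (intro sum_mono upper)
  also have "\<dots> = real (card \<beta>) / (2 * real n)"
    using C_pos by (simp add: r_powr)
  also have "\<dots> \<le> 1 / 2" using assms n by (simp add: field_simps)
  finally show False by simp
qed

definition gain_const :: real where
  "gain_const = c * far_const powr s * ln 3"

lemma gain_const_pos: "gain_const > 0"
  using c_pos far_const_pos by (simp add: gain_const_def)

text \<open>A far point gains in proportion to \<open>r powr s\<close> with \<open>r\<close> of
  order \<open>n powr (-1/s)\<close>, which is a multiple of \<open>1 / n\<close>.\<close>

lemma exists_insert_gain:
  assumes "finite \<beta>" "\<beta> \<noteq> {}" "card \<beta> \<le> n"
  shows "\<exists>x. log_error (insert x \<beta>) \<le> log_error \<beta> - gain_const / real n"
proof -
  define r where "r = far_const * (1 / real n) powr (1 / s)"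
  have n: "n > 0" using assms by (metis card_gt_0_iff le_0_eq not_gr0)
  obtain x where x: "x \<in> K" "4 * r \<le> infdist x \<beta>"
    using exists_far_point[OF assms] by (auto simp: r_def)
  have "(1 / real n) powr (1 / s) \<le> 1" using n s_pos by (intro powr_le1) auto
  then have "r \<le> D"
    using mult_mono[of far_const D "(1 / real n) powr (1 / s)" 1] D_pos by (simp add: r_def far_const_def)
  moreover have "r > 0" using far_const_pos n by (simp add: r_def)
  moreover have "r powr s = far_const powr s / real n"
    using far_const_pos s_pos n by (simp add: r_def powr_mult powr_powr)
  ultimately show ?thesis
    using log_error_insert_le[of \<beta> x r] x assms by (auto simp: gain_const_def)
qed

section \<open>Consequences of optimality\<close>

lemma card_optimal:
  assumes "\<alpha> \<in> optimal_sets n M"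
  shows "card \<alpha> = n"
proof (rule ccontr)
  note \<alpha> = optimal_setsD[OF assms]
  assume "card \<alpha> \<noteq> n"
  then have less: "card \<alpha> < n" using \<alpha>(1-3) by simp
  obtain x where x: "log_error (insert x \<alpha>) \<le> log_error \<alpha> - gain_const / real n"
    using exists_insert_gain \<alpha> by blast
  \<comment> \<open>With fewer than \<open>n\<close> points in \<alpha>, the enlarged set is still
    an admissible competitor.\<close>
  have "log_error \<alpha> \<le> log_error (insert x \<alpha>)"
    using \<alpha>(1-3) less by (intro \<alpha>(4)) (auto simp: card_insert_if)
  moreover have "gain_const / real n > 0" using gain_const_pos less by simp
  ultimately show False using x by simp
qed

text \<open>After the removal there is room for one point again. Adding a gaining point to the
  remaining \<open>n - 1\<close> gives a competitor that cannot beat \<alpha>, so the removal must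
  have cost at least that gain.\<close>

lemma log_error_optimal_remove:
  assumes "\<alpha> \<in> optimal_sets n M" "a \<in> \<alpha>" "\<alpha> - {a} \<noteq> {}"
  shows "log_error \<alpha> + gain_const / real n \<le> log_error (\<alpha> - {a})"
proof -
  note \<alpha> = optimal_setsD[OF assms(1)]
  have card: "card (\<alpha> - {a}) = n - 1" using card_optimal[OF assms(1)] assms(2) \<alpha>(1) by simp
  have fin: "finite (\<alpha> - {a})" using \<alpha>(1-3) by simp
  obtain x where x: "log_error (insert x (\<alpha> - {a})) \<le> log_error (\<alpha> - {a}) - gain_const / real n"
    using exists_insert_gain[OF fin assms(3), of n] card by auto
  have "n > 0" using assms(1) by (rule optimal_sets_pos)
  then have "log_error \<alpha> \<le> log_error (insert x (\<alpha> - {a}))"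
    using \<alpha>(1-3) card fin by (intro \<alpha>(4)) (auto simp: card_insert_if)
  then show ?thesis using x by simp
qed

text \<open>The removal of \<open>a\<close> costs at least \<open>gain_const / n\<close> by
  optimality and at most a multiple of the cell mass. If the condition \<open>near\<close> of the
  upper estimate fails, \<open>a\<close> is close to \<open>K\<close> and the other points are so
  remote that \<open>K\<close> lies in the strict cell. That cell then has mass 1, whence the
  minimum with 1.\<close>

lemma measure_strict_cell_optimal_ge:
  assumes "\<alpha> \<in> optimal_sets n M" "a \<in> \<alpha>" "\<alpha> - {a} \<noteq> {}"
  shows "min 1 (gain_const / removal_const) / real n \<le> measure M (strict_cell a \<alpha>)"
proof (cases "\<exists>k\<in>K. dist a k \<le> infdist a (\<alpha> - {a}) / 8 \<and> 8 * D < infdist a (\<alpha> - {a})")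
  case True
  then obtain k where k: "k \<in> K" "dist a k \<le> infdist a (\<alpha> - {a}) / 8" "8 * D < infdist a (\<alpha> - {a})"
    by auto
  have n: "n > 0" using assms(1) by (rule optimal_sets_pos)
  have "AE x in M. x \<in> strict_cell a \<alpha>"
    using AE_K
  proof eventually_elim
    case (elim x)
    have "x \<in> ball a (infdist a (\<alpha> - {a}) / 2)"
      using dist_K[OF k(1) elim] dist_triangle[of a x k] k D_pos unfolding mem_ball by linarith
    then show ?case using ball_subset_strict_cell[of "infdist a (\<alpha> - {a}) / 2" a \<alpha>] by auto
  qed
  then have "measure M (strict_cell a \<alpha>) = 1" by (subst prob_eq_1) (auto simp: strict_cell_sets)
  moreover have "min 1 (gain_const / removal_const) / real n \<le> 1 / 1"
    using n by (intro frac_le) auto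
  ultimately show ?thesis by simp
next
  case False
  have "log_error (\<alpha> - {a}) \<le> log_error \<alpha> + removal_const * measure M (strict_cell a \<alpha>)"
    using optimal_setsD(1)[OF assms(1)] assms(2,3) False by (intro log_error_remove_le_measure) force+
  then have "gain_const / real n \<le> removal_const * measure M (strict_cell a \<alpha>)"
    using log_error_optimal_remove[OF assms] by simp
  then have "gain_const / real n / removal_const \<le> measure M (strict_cell a \<alpha>)"
    using removal_const_pos pos_divide_le_eq[of removal_const "gain_const / real n"]
    by (simp only: mult.commute)
  moreover have "min 1 (gain_const / removal_const) / real n \<le> gain_const / removal_const / real n"
    by (intro divide_right_mono) auto
  ultimately show ?thesis by (simp add: mult.commute)
qed

text \<open>A crude bound from comparison with the single point \<open>x\<close>, whose error is at
  most \<open>ln D\<close>. It ensures that a quarter of the distance is an admissible radius in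
  \<open>log_error_insert_le\<close>.\<close>

lemma infdist_optimal_le_diameter:
  assumes "\<alpha> \<in> optimal_sets n M" "x \<in> K"
  shows "infdist x \<alpha> \<le> 2 * D"
proof (rule ccontr)
  note \<alpha> = optimal_setsD[OF assms(1)]
  assume "\<not> ?thesis"
  then have R: "infdist x \<alpha> - D > D" by simp
  have one: "(\<integral>y. r \<partial>M) = r" for r :: real using prob_space by simp
  have "ln (infdist x \<alpha> - D) \<le> log_error \<alpha>"
    unfolding log_error_def
  proof (subst one[symmetric], rule integral_mono_AE)
    show "AE y in M. ln (infdist x \<alpha> - D) \<le> ln (infdist y \<alpha>)"
      using AE_K
    proof eventually_elim
      case (elim y)
      have "infdist x \<alpha> - D \<le> infdist y \<alpha>"
        using infdist_triangle[of x \<alpha> y] dist_K[OF assms(2) elim] by simp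
      then show ?case using R D_pos by (intro ln_mono) auto
    qed
  qed (use \<alpha>(1-3) in \<open>auto intro: integrable_ln_infdist\<close>)
  also have "log_error \<alpha> \<le> log_error {x}"
    using \<alpha>(1-3) by (intro \<alpha>(4)) (auto simp: Suc_le_eq intro: optimal_sets_pos[OF assms(1)])
  also have "\<dots> \<le> ln D"
    unfolding log_error_def
  proof (subst one[symmetric], rule integral_mono_AE)
    show "AE y in M. ln (infdist y {x}) \<le> ln D"
      using AE_K AE_not_in_finite[of "{x}", OF finite.insertI[OF finite.emptyI]]
    proof eventually_elim
      case (elim y)
      then show ?case using dist_K[OF elim(1) assms(2)] by (auto intro!: ln_mono)
    qed
  qed (use integrable_ln_infdist[of "{x}"] in auto)
  finally show False using R D_pos by simp
qed

section \<open>Covering radius of an optimal set\<close>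

definition cover_const :: real where
  "cover_const = 4 * (removal_const / (c * ln 3)) powr (1 / s)"

lemma cover_const_pos: "cover_const > 0"
  using removal_const_pos c_pos by (simp add: cover_const_def)

text \<open>Adding \<open>x\<close> to an optimal set and then dropping the old point with the lightest cell
  cannot decrease the error, so the gain at \<open>x\<close> is at most the cost of that removal.\<close>

lemma infdist_optimal_le:
  assumes "\<alpha> \<in> optimal_sets n M" "x \<in> K"
  shows "infdist x \<alpha> \<le> cover_const * (1 / real n) powr (1 / s)"
proof (cases "infdist x \<alpha> = 0")
  case True
  then show ?thesis using cover_const_pos by simp
next
  case False
  note \<alpha> = optimal_setsD[OF assms(1)] and card = card_optimal[OF assms(1)]
  define r where "r = infdist x \<alpha> / 4"
  define \<beta> where "\<beta> = insert x \<alpha>"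
  have r: "0 < r" "r \<le> D"
    using False infdist_nonneg[of x \<alpha>] infdist_optimal_le_diameter[OF assms] D_pos by (auto simp: r_def)
  have n: "n > 0" using assms(1) by (rule optimal_sets_pos)
  have x: "x \<notin> \<alpha>" using False by auto
  have gain: "log_error \<beta> \<le> log_error \<alpha> - c * r powr s * ln 3"
    unfolding \<beta>_def using \<alpha>(1-3) assms r by (intro log_error_insert_le) (auto simp: r_def)
  \<comment> \<open>The light cell is sought among the \<open>n\<close> old points, so that
    \<open>x\<close> survives and the competitor \<open>\<beta> - {b}\<close> has \<open>n\<close>
    points again.\<close>
  obtain b where b: "b \<in> \<alpha>" "measure M (strict_cell b \<beta>) \<le> 1 / real n"
    using exists_light_strict_cell[of \<alpha> \<beta>] \<alpha> card by (auto simp: \<beta>_def)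
  have x_in: "x \<in> \<beta> - {b}" using b x by (auto simp: \<beta>_def)
  have "log_error \<alpha> \<le> log_error (\<beta> - {b})"
    using \<alpha>(1-3) b x card n x_in by (intro \<alpha>(4)) (auto simp: \<beta>_def)
  also have "\<dots> \<le> log_error \<beta> + removal_const * measure M (strict_cell b \<beta>)"
  proof (rule log_error_remove_le_measure)
    fix k assume k: "k \<in> K" "dist b k \<le> infdist b (\<beta> - {b}) / 8"
    \<comment> \<open>With \<delta> for this distance, the path from \<open>b\<close> to
      \<open>x\<close> through \<open>k\<close> gives
      \<open>\<delta> \<le> \<delta> / 8 + D\<close>.\<close>
    have "infdist b (\<beta> - {b}) \<le> dist b x" using x_in by (rule infdist_le)
    then show "infdist b (\<beta> - {b}) \<le> 8 * D"
      using dist_K[OF k(1) assms(2)] dist_triangle[of b x k] k(2) D_pos by linarith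
  qed (use \<alpha>(1-3) b x_in in \<open>auto simp: \<beta>_def\<close>)
  also have "\<dots> \<le> log_error \<beta> + removal_const * (1 / real n)"
    using b(2) removal_const_pos by (intro add_left_mono mult_left_mono) auto
  \<comment> \<open>Solving for \<open>r\<close>, a quarter of the distance, produces
    \<open>cover_const\<close> with its factor 4.\<close>
  finally have "c * r powr s * ln 3 \<le> removal_const * (1 / real n)" using gain by simp
  then have "r powr s * (c * ln 3) \<le> removal_const * (1 / real n)"
    by (simp add: ac_simps)
  then have "r powr s \<le> removal_const * (1 / real n) / (c * ln 3)"
    using c_pos by (subst pos_le_divide_eq) auto
  then have "r powr s \<le> removal_const / (c * ln 3) * (1 / real n)"
    by (simp add: mult.commute)
  then have "(r powr s) powr (1 / s) \<le> (removal_const / (c * ln 3) * (1 / real n)) powr (1 / s)"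
    using s_pos by (intro powr_mono2) auto
  also have "\<dots> = (removal_const / (c * ln 3)) powr (1 / s) * (1 / real n) powr (1 / s)"
    by (rule powr_mult)
  also have "(r powr s) powr (1 / s) = r"
    using r s_pos by (simp add: powr_powr)
  finally have "r \<le> (removal_const / (c * ln 3)) powr (1 / s) * (1 / real n) powr (1 / s)" .
  then show ?thesis by (simp add: r_def cover_const_def)
qed

section \<open>Masses of the cells of a Voronoi partition\<close>

lemma voronoi_partition_cell_near:
  assumes "\<alpha> \<in> optimal_sets n M" "voronoi_partition \<alpha> P" "a \<in> \<alpha>" "x \<in> P a" "x \<in> K"
  shows "dist a x \<le> cover_const * (1 / real n) powr (1 / s)"
  using infdist_optimal_le[OF assms(1,5)] assms
  by (auto simp: voronoi_partition_def voronoi_region_def dist_commute subset_iff)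

text \<open>The cell containing \<open>x\<close> belongs to a nearest point, and in the strict cell
  \<open>a\<close> is the only one. If \<open>a\<close> were the only point, the strict cell would
  be empty because \<open>infdist\<close> to the empty set is 0; that case is treated
  separately.\<close>

lemma strict_cell_subset_partition:
  assumes "voronoi_partition \<alpha> P" "a \<in> \<alpha>" "\<alpha> - {a} \<noteq> {}"
  shows "strict_cell a \<alpha> \<subseteq> P a"
proof
  fix x assume x: "x \<in> strict_cell a \<alpha>"
  have "x \<in> (\<Union>b\<in>\<alpha>. P b)" using assms by (simp add: voronoi_partition_def)
  then obtain b where b: "b \<in> \<alpha>" "x \<in> P b" by blast
  have "infdist x \<alpha> \<le> dist x a" using assms by (intro infdist_le)
  moreover have "infdist x \<alpha> = dist x b" using b assms by (auto simp: voronoi_partition_def voronoi_region_def)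
  ultimately have "b = a" using x b infdist_le[of b "\<alpha> - {a}" x] by (auto simp: strict_cell_def)
  then show "x \<in> P a" using b by simp
qed

lemma partition_singleton:
  assumes "voronoi_partition \<alpha> P" "a \<in> \<alpha>" "\<alpha> - {a} = {}"
  shows "P a = UNIV"
proof -
  have "\<alpha> = {a}" using assms by auto
  then show ?thesis using assms by (simp add: voronoi_partition_def)
qed

definition mass_const :: real where
  "mass_const = C * cover_const powr s"

lemma mass_const_pos: "mass_const > 0"
  using C_pos cover_const_pos by (simp add: mass_const_def)

lemma partition_sets:
  "voronoi_partition \<alpha> P \<Longrightarrow> a \<in> \<alpha> \<Longrightarrow> P a \<in> sets M"
  by (simp add: voronoi_partition_def sets_M)

text \<open>The cell itself may be unbounded, but its part in \<open>K\<close> lies within the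
  covering radius of \<open>a\<close>, and only that part carries mass.\<close>

lemma measure_partition_le:
  assumes "\<alpha> \<in> optimal_sets n M" "voronoi_partition \<alpha> P" "a \<in> \<alpha>"
  shows "measure M (P a) \<le> mass_const / real n"
proof -
  define r where "r = cover_const * (1 / real n) powr (1 / s)"
  have n: "n > 0" using assms(1) by (rule optimal_sets_pos)
  have "measure M (P a) \<le> measure M (cball a r)"
  proof (rule finite_measure_mono_AE)
    show "AE x in M. x \<in> P a \<longrightarrow> x \<in> cball a r"
      using AE_K
      by eventually_elim (use voronoi_partition_cell_near[OF assms] in \<open>auto simp: r_def\<close>)
  qed (auto simp: cball_sets)
  also have "\<dots> \<le> C * r powr s" using n cover_const_pos by (intro upper) (simp add: r_def)
  also have "\<dots> = mass_const / real n"
    using n cover_const_pos s_pos by (simp add: r_def mass_const_def powr_mult powr_powr)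
  finally show ?thesis .
qed

lemma measure_partition_ge:
  assumes "\<alpha> \<in> optimal_sets n M" "voronoi_partition \<alpha> P" "a \<in> \<alpha>"
  shows "min 1 (gain_const / removal_const) / real n \<le> measure M (P a)"
proof (cases "\<alpha> - {a} = {}")
  case True
  have "\<alpha> = {a}" using True assms by auto
  then have "n = 1" using card_optimal[OF assms(1)] by simp
  then show ?thesis
    using partition_singleton[OF assms(2,3) True] prob_space by simp
next
  case False
  have "measure M (strict_cell a \<alpha>) \<le> measure M (P a)"
    using strict_cell_subset_partition[OF assms(2,3) False] partition_sets[OF assms(2,3)]
    by (intro finite_measure_mono)
  then show ?thesis using measure_strict_cell_optimal_ge[OF assms(1,3) False] by simp
qed

section \<open>Separation of optimal points and inner balls\<close>

definition separation_const :: real where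
  "separation_const = (gain_const / (2 * log_ball_const)) powr (1 / s) * (gain_const / (2 * mass_const))"

lemma separation_const_pos: "separation_const > 0"
  using gain_const_pos log_ball_const_pos mass_const_pos by (simp add: separation_const_def)

text \<open>Removing \<open>a\<close> must cost at least \<open>gain_const / n\<close>. The singular
  term uses up at most half of this, and since the cell has mass at most
  \<open>mass_const / n\<close>, the other half forces \<open>\<delta> / r\<close> to be bounded
  below.\<close>

lemma optimal_separation:
  assumes "\<alpha> \<in> optimal_sets n M" "voronoi_partition \<alpha> P" "a \<in> \<alpha>" "\<alpha> - {a} \<noteq> {}"
  shows "separation_const * (1 / real n) powr (1 / s) \<le> infdist a (\<alpha> - {a})"
proof -
  \<comment> \<open>Chosen so that \<open>log_ball_const * r powr s\<close> equals half of
    \<open>gain_const / n\<close>.\<close>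
  define r where "r = (gain_const / (2 * log_ball_const)) powr (1 / s) * (1 / real n) powr (1 / s)"
  define \<delta> where "\<delta> = infdist a (\<alpha> - {a})"
  have n: "n > 0" using assms(1) by (rule optimal_sets_pos)
  have r: "r > 0" using n gain_const_pos log_ball_const_pos by (simp add: r_def)
  have r_powr: "r powr s = gain_const / (2 * log_ball_const) * (1 / real n)"
    using n gain_const_pos log_ball_const_pos s_pos by (simp add: r_def powr_mult powr_powr)
  have \<delta>: "\<delta> \<ge> 0" by (simp add: \<delta>_def infdist_nonneg)
  have "gain_const / real n \<le> (\<integral>x. log_ball a r x \<partial>M) + measure M (strict_cell a \<alpha>) * ln (1 + \<delta> / r)"
    using log_error_remove_le[OF _ assms(3,4) r] optimal_setsD(1)[OF assms(1)]
      log_error_optimal_remove[OF assms(1,3,4)] by (simp add: \<delta>_def)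
  also have "(\<integral>x. log_ball a r x \<partial>M) \<le> log_ball_const * r powr s"
    using r by (rule integral_log_ball)
  also have "\<dots> = gain_const / (2 * real n)"
    using log_ball_const_pos by (simp add: r_powr)
  also have "measure M (strict_cell a \<alpha>) * ln (1 + \<delta> / r) \<le> mass_const / real n * (\<delta> / r)"
  proof (rule mult_mono)
    have "measure M (strict_cell a \<alpha>) \<le> measure M (P a)"
      using strict_cell_subset_partition[OF assms(2-4)] partition_sets[OF assms(2,3)]
      by (intro finite_measure_mono)
    then show "measure M (strict_cell a \<alpha>) \<le> mass_const / real n"
      using measure_partition_le[OF assms(1-3)] by simp
    show "ln (1 + \<delta> / r) \<le> \<delta> / r" using \<delta> r by (intro ln_add_one_self_le_self) simp
  qed (use \<delta> r mass_const_pos in auto)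
  finally have "gain_const / (2 * real n) \<le> mass_const / real n * (\<delta> / r)" by simp
  then have "r * (gain_const / (2 * mass_const)) \<le> \<delta>"
    using n r mass_const_pos by (simp add: field_simps)
  then show ?thesis by (simp add: r_def \<delta>_def separation_const_def algebra_simps)
qed

text \<open>The diameter is at most twice the covering radius, so the factor 8 brings the radius
  down to a quarter of the separation bound, inside the ball of half that bound which the strict
  cell contains.\<close>

definition inner_const :: real where
  "inner_const = separation_const / (8 * cover_const)"

lemma inner_const_pos: "inner_const > 0"
  using separation_const_pos cover_const_pos by (simp add: inner_const_def)

lemma cball_subset_partition:
  assumes "\<alpha> \<in> optimal_sets n M" "voronoi_partition \<alpha> P" "a \<in> \<alpha>"
  shows "cball a (inner_const * diameter (P a \<inter> K)) \<subseteq> P a"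
proof (cases "\<alpha> - {a} = {}")
  case True
  then show ?thesis using partition_singleton[OF assms(2,3)] by simp
next
  case False
  define t where "t = (1 / real n) powr (1 / s)"
  have n: "n > 0" using assms(1) by (rule optimal_sets_pos)
  have t: "t > 0" using n by (simp add: t_def)
  have "dist x y \<le> 2 * (cover_const * t)" if "x \<in> P a \<inter> K" "y \<in> P a \<inter> K" for x y
    using that voronoi_partition_cell_near[OF assms, of x] voronoi_partition_cell_near[OF assms, of y]
      dist_triangle3[of x y a] by (simp add: t_def)
  \<comment> \<open>If \<open>P a\<close> misses \<open>K\<close>, the diameter is 0 by convention
    and the bound is trivial.\<close>
  then have "diameter (P a \<inter> K) \<le> 2 * (cover_const * t)"
    using cover_const_pos t by (auto simp: diameter_def intro!: cSUP_least)
  then have "inner_const * diameter (P a \<inter> K) \<le> inner_const * (2 * (cover_const * t))"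
    using inner_const_pos by (intro mult_left_mono) auto
  also have "\<dots> = separation_const * t / 4"
    using cover_const_pos by (simp add: inner_const_def)
  also have "\<dots> < separation_const * t / 2"
    using separation_const_pos t by simp
  finally have "cball a (inner_const * diameter (P a \<inter> K)) \<subseteq> ball a (separation_const * t / 2)"
    by auto
  also have "\<dots> \<subseteq> strict_cell a \<alpha>"
    using optimal_separation[OF assms False] by (intro ball_subset_strict_cell) (simp add: t_def)
  also have "\<dots> \<subseteq> P a" using strict_cell_subset_partition[OF assms(2,3) False] .
  finally show ?thesis .
qed

end

section \<open>From Ahlfors-David measures to regular measures\<close>

lemma AE_msupport:
  fixes M :: "'a::second_countable_topology measure"
  assumes "sets M = sets borel"
  shows "AE x in M. x \<in> msupport M"
proof -
  define F where "F = {U. open U \<and> emeasure M U = 0}"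
  \<comment> \<open>The complement of the support is the union of the open null sets, and by the
    Lindelof property countably many of them suffice.\<close>
  obtain F' where F': "F' \<subseteq> F" "countable F'" "\<Union>F' = \<Union>F"
    using Lindelof[of F] by (auto simp: F_def)
  have "(\<Union>U\<in>F'. U) \<in> null_sets M"
    using F' assms by (intro null_sets_UN') (auto simp: F_def null_sets_def)
  then show ?thesis
    using F'(3) by (intro AE_I'[of "\<Union>F'"]) (auto simp: msupport_def F_def zero_less_iff_neq_zero)
qed

text \<open>Some ball about \<open>z\<close> has mass above \<open>1 - e\<close>. A remote point of
  the support would have a disjoint ball of mass at least \<open>e\<close>, and the total would
  exceed 1.\<close>

lemma bounded_msupport:
  fixes M :: "'a::{metric_space, second_countable_topology} measure"
  assumes "prob_space M" "sets M = sets borel" "0 < r" "0 < e"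
    and "\<And>x. x \<in> msupport M \<Longrightarrow> e \<le> measure M (cball x r)"
  shows "bounded (msupport M)"
proof -
  interpret prob_space M by fact
  have [simp]: "space M = UNIV" using sets_eq_imp_space_eq[OF assms(2)] by simp
  fix z :: 'a
  have Un: "(\<Union>i. cball z (real i)) = UNIV"
    by (auto intro: real_arch_simple)
  have "(\<lambda>i. measure M (cball z (real i))) \<longlonglongrightarrow> measure M (\<Union>i. cball z (real i))"
  proof (rule finite_Lim_measure_incseq)
    show "range (\<lambda>i. cball z (real i)) \<subseteq> sets M" by (auto simp: assms(2))
    show "incseq (\<lambda>i. cball z (real i))" by (intro monoI subset_cball) simp
  qed
  then have "(\<lambda>i. measure M (cball z (real i))) \<longlonglongrightarrow> 1"
    using prob_space Un by simp
  then have "\<forall>\<^sub>F i in sequentially. measure M (cball z (real i)) > 1 - e"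
    using assms(4) by (intro order_tendstoD) auto
  then obtain N where N: "measure M (cball z (real N)) > 1 - e"
    by (auto simp: eventually_sequentially)
  have "msupport M \<subseteq> cball z (real N + r)"
  proof
    fix x assume x: "x \<in> msupport M"
    show "x \<in> cball z (real N + r)"
    proof (rule ccontr)
      assume far: "x \<notin> cball z (real N + r)"
      have "cball z (real N) \<inter> cball x r = {}"
      proof (rule ccontr)
        assume "cball z (real N) \<inter> cball x r \<noteq> {}"
        then obtain y where "dist z y \<le> real N" "dist x y \<le> r" by auto
        then show False using far dist_triangle2[of z x y] by simp
      qed
      then have "measure M (cball z (real N)) + measure M (cball x r)
          = measure M (cball z (real N) \<union> cball x r)"
        using assms(2) by (intro finite_measure_Union[symmetric]) auto
      also have "\<dots> \<le> 1" by simp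
      finally show False using N assms(5)[OF x] by simp
    qed
  qed
  then show ?thesis using bounded_cball bounded_subset by blast
qed

lemma ahlfors_david_imp_regular_measure:
  fixes M :: "'a::{metric_space, second_countable_topology} measure"
  assumes "prob_space M" "ahlfors_david M s"
  shows "\<exists>C c D. regular_measure M (msupport M) s C c D"
proof -
  interpret prob_space M by fact
  define K where "K = msupport M"
  obtain C1 C2 e where M: "sets M = sets borel" "s > 0" "C1 > 0" "C2 > 0" "e > 0"
    and C1: "\<And>x r. x \<in> K \<Longrightarrow> 0 < r \<Longrightarrow> r < e \<Longrightarrow> ennreal (C1 * r powr s) \<le> emeasure M (cball x r)"
    and C2: "\<And>x r. x \<in> K \<Longrightarrow> 0 < r \<Longrightarrow> r < e \<Longrightarrow> emeasure M (cball x r) \<le> ennreal (C2 * r powr s)"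
    using assms(2) unfolding ahlfors_david_def K_def by blast
  have lo: "C1 * r powr s \<le> measure M (cball x r)" if "x \<in> K" "0 < r" "r < e" for x r
    using C1[OF that] by (simp add: emeasure_eq_measure)
  have up: "measure M (cball x r) \<le> C2 * r powr s" if "x \<in> K" "0 < r" "r < e" for x r
    using C2[OF that] M by (simp add: emeasure_eq_measure)
  have AE: "AE x in M. x \<in> K" unfolding K_def by (rule AE_msupport[OF M(1)])
  have "bounded K"
    unfolding K_def
    by (rule bounded_msupport[of M "e / 2" "C1 * (e / 2) powr s"]) (use assms M lo K_def in auto)
  then obtain D0 where D0: "\<And>x y. x \<in> K \<Longrightarrow> y \<in> K \<Longrightarrow> dist x y \<le> D0"
    unfolding bounded_two_points by blast
  define D where "D = max D0 e"
  \<comment> \<open>The factor \<open>2 powr s\<close> pays for moving the centre into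
    \<open>K\<close> at the price of doubling the radius. The term \<open>1 / e powr s\<close>
    covers the case \<open>2 * r \<ge> e\<close>, where the bound by the total mass 1 is
    enough.\<close>
  define C where "C = max C2 (1 / e powr s) * 2 powr s"
  \<comment> \<open>Shrinking a radius up to \<open>D\<close> by the factor
    \<open>e / (2 * D)\<close> brings it below \<open>e\<close>, where the given lower bound is
    valid.\<close>
  define c where "c = C1 * (e / (2 * D)) powr s"
  have D: "D > 0" "e \<le> D" using M by (auto simp: D_def)
  have "measure M (cball x r) \<le> C * r powr s" if r: "r > 0" for x r
  proof (cases "cball x r \<inter> K = {}")
    case True
    have "AE y in M. y \<notin> cball x r"
      using AE by eventually_elim (use True in auto)
    then have "measure M (cball x r) = 0"
      using M(1) by (subst prob_eq_0) auto
    then show ?thesis using M r by (simp add: C_def max_def)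
  next
    case False
    then obtain k where k: "k \<in> K" "dist x k \<le> r" by auto
    have C: "C * r powr s = max C2 (1 / e powr s) * (2 * r) powr s"
      by (simp add: C_def powr_mult)
    show ?thesis
    proof (cases "2 * r < e")
      case True
      have "cball x r \<subseteq> cball k (2 * r)"
      proof
        fix y assume "y \<in> cball x r"
        then show "y \<in> cball k (2 * r)"
          using k(2) dist_triangle3[of k y x] by simp
      qed
      then have "measure M (cball x r) \<le> measure M (cball k (2 * r))"
        using M(1) by (intro finite_measure_mono) auto
      also have "\<dots> \<le> C2 * (2 * r) powr s" using True r by (intro up[OF k(1)]) auto
      also have "\<dots> \<le> C * r powr s" unfolding C by (intro mult_right_mono) auto
      finally show ?thesis .
    next
      case False
      have "measure M (cball x r) \<le> 1" by simp
      also have "\<dots> \<le> 1 / e powr s * (2 * r) powr s"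
        using False M powr_mono2[of s e "2 * r"] by (simp add: field_simps)
      also have "\<dots> \<le> C * r powr s" unfolding C by (intro mult_right_mono) auto
      finally show ?thesis .
    qed
  qed
  moreover have "c * r powr s \<le> measure M (cball x r)" if "x \<in> K" "0 < r" "r \<le> D" for x r
  proof -
    define t where "t = e * r / (2 * D)"
    have t: "0 < t" "t < e" "t \<le> r" using that D M by (auto simp: t_def field_simps)
    have "c * r powr s = C1 * t powr s"
      using that D M by (simp add: c_def t_def powr_mult[symmetric])
    also have "\<dots> \<le> measure M (cball x t)" using lo[OF that(1) t(1,2)] .
    also have "\<dots> \<le> measure M (cball x r)"
      using t M(1) by (intro finite_measure_mono) auto
    finally show ?thesis .
  qed
  moreover have "C > 0" "c > 0" using M D by (auto simp: C_def c_def max_def)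
  ultimately have "regular_measure M K s C c D"
    using M D D0 AE by unfold_locales (auto simp: D_def le_max_iff_disj)
  then show ?thesis unfolding K_def by blast
qed

theorem theorem1p1:
  fixes \<mu> :: "(real ^ 'q) measure" and s\<^sub>0 :: real
  assumes "prob_space \<mu>" and "ahlfors_david \<mu> s\<^sub>0"
  shows "\<exists>d\<^sub>1 d\<^sub>2 d\<^sub>3 :: real. d\<^sub>1 > 0 \<and> d\<^sub>2 > 0 \<and> d\<^sub>3 > 0 \<and>
    (\<forall>n\<ge>1. \<forall>\<alpha>\<in>optimal_sets n \<mu>. \<forall>P. voronoi_partition \<alpha> P \<longrightarrow>
       d\<^sub>1 * inverse (real n) \<le> Min ((\<lambda>a. measure \<mu> (P a)) ` \<alpha>) \<and>
       Min ((\<lambda>a. measure \<mu> (P a)) ` \<alpha>) \<le> Max ((\<lambda>a. measure \<mu> (P a)) ` \<alpha>) \<and>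
       Max ((\<lambda>a. measure \<mu> (P a)) ` \<alpha>) \<le> d\<^sub>2 * inverse (real n) \<and>
       (\<forall>a\<in>\<alpha>. cball a (d\<^sub>3 * diameter (P a \<inter> msupport \<mu>)) \<subseteq> P a))"
proof -
  obtain C c D where "regular_measure \<mu> (msupport \<mu>) s\<^sub>0 C c D"
    using ahlfors_david_imp_regular_measure[OF assms] by blast
  then interpret regular_measure \<mu> "msupport \<mu>" s\<^sub>0 C c D .
  show ?thesis
  proof (intro exI conjI allI impI ballI)
    \<comment> \<open>The witnesses depend only on the measure and the locale constants, hence are
      uniform in \<open>n\<close>, \<alpha> and \<open>P\<close>.\<close>
    show "min 1 (gain_const / removal_const) > 0" "mass_const > 0" "inner_const > 0"
      using gain_const_pos removal_const_pos mass_const_pos inner_const_pos by auto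
    fix n \<alpha> P assume opt: "\<alpha> \<in> optimal_sets n \<mu>" and P: "voronoi_partition \<alpha> P"
    let ?A = "(\<lambda>a. measure \<mu> (P a)) ` \<alpha>"
    have fin: "finite ?A" "?A \<noteq> {}" using optimal_setsD(1,2)[OF opt] by auto
    show "min 1 (gain_const / removal_const) * inverse (real n) \<le> Min ?A"
      using fin measure_partition_ge[OF opt P] by (auto simp: divide_inverse)
    show "Min ?A \<le> Max ?A" using fin by (intro Min_le Max_in)
    show "Max ?A \<le> mass_const * inverse (real n)"
      using fin measure_partition_le[OF opt P] by (auto simp: divide_inverse)
    fix a assume "a \<in> \<alpha>"
    then show "cball a (inner_const * diameter (P a \<inter> msupport \<mu>)) \<subseteq> P a"
      by (rule cball_subset_partition[OF opt P])
  qed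
qed

end
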